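(* Let $n\ge1$, let $P_n$ be a complex polynomial of exact degree $n$, let $\alpha>0$, and let $$\mathfrak{f}_n=\{z\in\mathbb{C} : |P_n(z)|\le\alpha\}.$$ Define $$Q=\max_{j=0,\dots,n-1}\mathcal{W}_j(\mathfrak{f}_n).$$ Then $t_m^{(\mathfrak{f}_n)}\le Q\,C(\mathfrak{f}_n)^m$ for all $m\ge 0$.
   Context: For a compact, not finite, set $\mathfrak{e}\subset\mathbb{C}$, $\|f\|_{\mathfrak{e}}=\sup_{z\in\mathfrak{e}}|f(z)|$. The Chebyshev polynomial $T_m^{(\mathfrak{e})}$ is the unique monic polynomial of degree $m$ minimizing $\|P\|_{\mathfrak{e}}$ over all monic polynomials $P$ of degree $m$, and $t_m^{(\mathfrak{e})}=\|T_m^{(\mathfrak{e})}\|_{\mathfrak{e}}$ (so $T_0=1$, $t_0=1$). $C(\mathfrak{e})$ is the logarithmic capacity and $\mathcal{W}_m(\mathfrak{e})=t_m^{(\mathfrak{e})}/C(\mathfrak{e})^m$ are the Widom factors. *)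

theory Defs
  imports "HOL-Probability.Probability" "HOL-Computational_Algebra.Polynomial"
begin

definition sup_norm :: "complex set \<Rightarrow> (complex \<Rightarrow> complex) \<Rightarrow> real" where
  "sup_norm E f = (SUP z\<in>E. cmod (f z))"

definition monic_of_degree :: "nat \<Rightarrow> complex poly \<Rightarrow> bool" where
  "monic_of_degree m p \<longleftrightarrow> degree p = m \<and> lead_coeff p = 1"

definition is_chebyshev_poly :: "complex set \<Rightarrow> nat \<Rightarrow> complex poly \<Rightarrow> bool" where
  "is_chebyshev_poly E m p \<longleftrightarrow> monic_of_degree m p \<and>
     (\<forall>q. monic_of_degree m q \<longrightarrow> sup_norm E (poly p) \<le> sup_norm E (poly q))"

(* Meaningful for compact, infinite E, where the minimizer exists and is unique. *)
definition chebyshev_poly :: "complex set \<Rightarrow> nat \<Rightarrow> complex poly" where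
  "chebyshev_poly E m = (THE p. is_chebyshev_poly E m p)"

definition chebyshev_norm :: "complex set \<Rightarrow> nat \<Rightarrow> real" where
  "chebyshev_norm E m = sup_norm E (poly (chebyshev_poly E m))"

(* The kernel log (1 / |z - w|). The diagonal is split off because ln 0 = 0 in HOL,
   whereas the kernel must be infinite there. *)
definition log_kernel :: "complex \<Rightarrow> complex \<Rightarrow> ereal" where
  "log_kernel z w = (if z = w then \<infinity> else ereal (ln (1 / cmod (z - w))))"

(* The double integral of log_kernel against \<mu>, with values in (-\<infinity>, \<infinity>], written as
   the integral of the positive part minus that of the negative part (e2ennreal truncates
   negative values to 0). The second integral is finite for \<mu> of bounded support. *)
definition log_energy :: "complex measure \<Rightarrow> ereal" where
  "log_energy \<mu> =
     enn2ereal (\<integral>\<^sup>+ z. (\<integral>\<^sup>+ w. e2ennreal (log_kernel z w) \<partial>\<mu>) \<partial>\<mu>) -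
     enn2ereal (\<integral>\<^sup>+ z. (\<integral>\<^sup>+ w. e2ennreal (- log_kernel z w) \<partial>\<mu>) \<partial>\<mu>)"

definition prob_measures_on :: "complex set \<Rightarrow> complex measure set" where
  "prob_measures_on E = {\<mu>. prob_space \<mu> \<and> sets \<mu> = sets borel \<and> emeasure \<mu> E = 1}"

definition robin_constant :: "complex set \<Rightarrow> ereal" where
  "robin_constant E = (INF \<mu>\<in>prob_measures_on E. log_energy \<mu>)"

(* exp (- robin_constant E), with exp (-\<infinity>) = 0. For compact E the Robin constant is never
   -\<infinity>, so the value in that case is irrelevant. *)
definition log_capacity :: "complex set \<Rightarrow> real" where
  "log_capacity E =
     (if robin_constant E = \<infinity> then 0 else exp (- real_of_ereal (robin_constant E)))"

definition widom_factor :: "complex set \<Rightarrow> nat \<Rightarrow> real" where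
  "widom_factor E m = chebyshev_norm E m / log_capacity E ^ m"

end

theory Submission
  imports Defs "HOL-Complex_Analysis.Complex_Analysis"
    "HOL-Computational_Algebra.Fundamental_Theorem_Algebra"
begin

text \<open>Write \<open>a\<close> for the leading coefficient of \<open>P\<close>. If \<open>m = n k + j\<close>, then \<open>T\<^sub>j (P / a)^k\<close> is
  monic of degree \<open>m\<close>, so \<open>t\<^sub>m \<le> t\<^sub>j (\<alpha> / |a|)^k\<close>, and it remains to bound \<open>\<alpha> / |a|\<close> by
  \<open>C(f)^n\<close>. Let \<open>\<mu>\<close> be the pull-back under \<open>P\<close> of the uniform distribution on the circle
  \<open>|w| = \<alpha>\<close>: pick \<open>w\<close> uniformly and then one of the \<open>n\<close> roots of \<open>P - w\<close> uniformly.
  The logarithmic potential of \<open>\<mu>\<close> at \<open>z\<close> is \<open>1/n\<close> times the mean of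
  \<open>ln (|a| / |P z - w|)\<close> over the circle, which for \<open>|P z| = \<alpha>\<close> is at most
  \<open>ln (|a| / \<alpha>) / n\<close>. Hence the energy of \<open>\<mu>\<close>, and with it the Robin constant of \<open>f\<close>, is at
  most \<open>ln (|a| / \<alpha>) / n\<close>. To make \<open>\<mu>\<close> available, the roots of a polynomial are chosen as
  measurable functions of its coefficients.\<close>

section \<open>Measurable choice of roots\<close>

lemma compact_poly_sublevel:
  fixes p :: "complex poly"
  assumes "degree p > 0"
  shows "compact {z. cmod (poly p z) \<le> c}"
proof -
  \<comment> \<open>The constant coefficient is split off because growth at infinity only requires
    the tail \<open>q\<close> to be nonzero.\<close>
  obtain a q where p: "p = pCons a q" by (cases p)
  with assms have "q \<noteq> 0" by auto
  from poly_infinity[OF this, of "c + 1" a] obtain r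
    where r: "\<And>z. r \<le> cmod z \<Longrightarrow> c + 1 \<le> cmod (poly p z)" unfolding p by blast
  have "{z. cmod (poly p z) \<le> c} \<subseteq> cball 0 r"
    using r by (auto simp: dist_norm) (smt (verit))
  moreover have "closed {z. cmod (poly p z) \<le> c}"
    by (intro closed_Collect_le continuous_intros)
  ultimately show ?thesis
    using bounded_cball bounded_subset compact_eq_bounded_closed by blast
qed

text \<open>The strict sublevel set is open and contains a root of \<open>p\<close>, and a nonempty
  open subset of the plane cannot be finite.\<close>

lemma infinite_poly_sublevel:
  fixes p :: "complex poly"
  assumes "degree p > 0" "c > 0"
  shows "infinite {z. cmod (poly p z) \<le> c}"
proof
  assume "finite {z. cmod (poly p z) \<le> c}"
  then have "finite {z. cmod (poly p z) < c}" by (rule rev_finite_subset) auto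
  moreover obtain z where "poly p z = 0"
    using alg_closed_imp_poly_has_root[OF assms(1)] by blast
  then have "z \<in> {z. cmod (poly p z) < c}" using assms(2) by simp
  moreover have "open {z. cmod (poly p z) < c}"
    by (intro open_Collect_less continuous_intros)
  ultimately show False using finite_imp_not_open by blast
qed

section \<open>Approximate roots, and roots depending measurably on coefficients\<close>

text \<open>Points with small polynomial values stay in a compact sublevel set, so they accumulate
  at genuine roots. This allows roots to be detected by inequalities on a countable dense
  set.\<close>

lemma poly_tendsto_0_imp_subseq_root:
  fixes p :: "complex poly"
  assumes "degree p > 0" and lim: "(\<lambda>k. poly p (d k)) \<longlonglongrightarrow> 0"
  obtains z r where "poly p z = 0" "strict_mono (r :: nat \<Rightarrow> nat)" "(d \<circ> r) \<longlonglongrightarrow> z"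
proof -
  from lim have "Bseq (\<lambda>k. poly p (d k))"
    by (intro convergent_imp_Bseq convergentI)
  then obtain c where "\<And>k. cmod (poly p (d k)) \<le> c" by (auto simp: Bseq_def)
  then have "\<forall>k. d k \<in> {z. cmod (poly p z) \<le> c}" by simp
  with compact_poly_sublevel[OF assms(1), of c] obtain z r
    where r: "strict_mono r" "(d \<circ> r) \<longlonglongrightarrow> z"
    unfolding compact_def by metis
  have "(\<lambda>k. poly p ((d \<circ> r) k)) \<longlonglongrightarrow> poly p z"
    by (intro tendsto_intros r)
  moreover have "(\<lambda>k. poly p ((d \<circ> r) k)) \<longlonglongrightarrow> 0"
    using LIMSEQ_subseq_LIMSEQ[OF lim r(1)] by (simp add: o_def)
  ultimately have "poly p z = 0" by (rule LIMSEQ_unique)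
  with r that show ?thesis by blast
qed

lemma borel_measurable_poly_param:
  fixes p :: "'a \<Rightarrow> complex poly"
  assumes [measurable]: "\<And>i. (\<lambda>\<omega>. coeff (p \<omega>) i) \<in> borel_measurable M" "z \<in> borel_measurable M"
    and deg: "\<And>\<omega>. degree (p \<omega>) = n"
  shows "(\<lambda>\<omega>. poly (p \<omega>) (z \<omega>)) \<in> borel_measurable M"
  unfolding poly_altdef deg by measurable

text \<open>The root that is minimal in the lexicographic order of real and imaginary part is
  a measurable function of the coefficients: both coordinates are characterised by countably
  many conditions on the values of the polynomial on a countable dense set.\<close>

lemma measurable_root_selection:
  fixes p :: "'a \<Rightarrow> complex poly"
  assumes meas: "\<And>i. (\<lambda>\<omega>. coeff (p \<omega>) i) \<in> borel_measurable M"
    and deg: "\<And>\<omega>. degree (p \<omega>) = n" and "n > 0"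
  obtains \<zeta> where "\<zeta> \<in> borel_measurable M" "\<And>\<omega>. poly (p \<omega>) (\<zeta> \<omega>) = 0"
proof -
  have [measurable]: "(\<lambda>\<omega>. poly (p \<omega>) d) \<in> borel_measurable M" for d
    by (rule borel_measurable_poly_param[OF meas _ deg]) simp
  obtain D :: "complex set" where D: "countable D"
    "\<And>X. open X \<Longrightarrow> X \<noteq> {} \<Longrightarrow> \<exists>d\<in>D. d \<in> X"
    using countable_dense_exists by metis
  have Dne: "D \<noteq> {}" using D(2)[of UNIV] by auto
  define Z where "Z \<omega> = {z. poly (p \<omega>) z = 0}" for \<omega>
  have p0: "p \<omega> \<noteq> 0" for \<omega> using deg[of \<omega>] \<open>n > 0\<close> by auto
  have Zfin: "finite (Z \<omega>)" for \<omega>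
    unfolding Z_def by (rule poly_roots_finite[OF p0])
  have Zne: "Z \<omega> \<noteq> {}" for \<omega>
    using alg_closed_imp_poly_has_root[of "p \<omega>"] deg \<open>n > 0\<close> unfolding Z_def by force
  define x where "x \<omega> = Min (Re ` Z \<omega>)" for \<omega>
  define Y where "Y \<omega> = {z \<in> Z \<omega>. Re z = x \<omega>}" for \<omega>
  have Yfin: "finite (Y \<omega>)" for \<omega> using Zfin unfolding Y_def by auto
  have Yne: "Y \<omega> \<noteq> {}" for \<omega>
  proof -
    have "x \<omega> \<in> Re ` Z \<omega>" unfolding x_def using Zfin Zne by (intro Min_in) auto
    then show ?thesis unfolding Y_def by auto
  qed
  define y where "y \<omega> = Min (Im ` Y \<omega>)" for \<omega>
  have root: "poly (p \<omega>) (Complex (x \<omega>) (y \<omega>)) = 0" for \<omega>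
  proof -
    have "y \<omega> \<in> Im ` Y \<omega>" unfolding y_def using Yfin Yne by (intro Min_in) auto
    then obtain z where "z \<in> Y \<omega>" "y \<omega> = Im z" by auto
    then have "Complex (x \<omega>) (y \<omega>) = z" "poly (p \<omega>) z = 0"
      unfolding Y_def Z_def by (auto simp: complex_eq_iff)
    then show ?thesis by simp
  qed
  have lim0: "(\<lambda>k. poly (p \<omega>) (d k)) \<longlonglongrightarrow> 0"
    if "\<And>k. cmod (poly (p \<omega>) (d k)) < 1 / Suc k" for \<omega> and d :: "nat \<Rightarrow> complex"
    by (rule Lim_null_comparison[OF _ LIMSEQ_inverse_real_of_nat])
       (use that in \<open>auto simp: inverse_eq_divide less_imp_le\<close>)
  \<comment> \<open>From left to right, the selected root lies in an open set that \<open>D\<close>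
    must meet. From right to left, approximate roots accumulate at a root with real part at most
    \<open>r\<close>; the gap \<open>r < c\<close> restores strictness.\<close>
  have x_less: "x \<omega> < c \<longleftrightarrow> (\<exists>r\<in>\<rat>. r < c \<and>
      (\<forall>k::nat. \<exists>d\<in>D. Re d < r \<and> cmod (poly (p \<omega>) d) < 1 / Suc k))" for \<omega> c
  proof
    assume "x \<omega> < c"
    then obtain r where r: "r \<in> \<rat>" "x \<omega> < r" "r < c" using Rats_dense_in_real by blast
    have "\<exists>d\<in>D. Re d < r \<and> cmod (poly (p \<omega>) d) < 1 / Suc k" for k
    proof -
      have "open {d. Re d < r \<and> cmod (poly (p \<omega>) d) < 1 / Suc k}"
        by (intro open_Collect_conj open_Collect_less continuous_intros)
      moreover have "Complex (x \<omega>) (y \<omega>) \<in> {d. Re d < r \<and> cmod (poly (p \<omega>) d) < 1 / Suc k}"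
        using r root by simp
      ultimately show ?thesis using D(2) by blast
    qed
    with r show "\<exists>r\<in>\<rat>. r < c \<and>
      (\<forall>k::nat. \<exists>d\<in>D. Re d < r \<and> cmod (poly (p \<omega>) d) < 1 / Suc k)" by blast
  next
    assume "\<exists>r\<in>\<rat>. r < c \<and>
      (\<forall>k::nat. \<exists>d\<in>D. Re d < r \<and> cmod (poly (p \<omega>) d) < 1 / Suc k)"
    then obtain r d where r: "r < c"
      and d: "\<And>k::nat. Re (d k) < r" "\<And>k::nat. cmod (poly (p \<omega>) (d k)) < 1 / Suc k"
      by metis
    obtain z s where z: "poly (p \<omega>) z = 0" "(d \<circ> s) \<longlonglongrightarrow> z"
      using poly_tendsto_0_imp_subseq_root[OF _ lim0[OF d(2)]] deg \<open>n > 0\<close> by metis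
    have "Re z \<le> r"
      by (rule LIMSEQ_le_const2[OF tendsto_Re[OF z(2)]]) (use d in \<open>auto simp: less_imp_le\<close>)
    moreover have "x \<omega> \<le> Re z"
      unfolding x_def using Zfin z(1) by (intro Min_le) (auto simp: Z_def)
    ultimately show "x \<omega> < c" using r by simp
  qed
  have [measurable]: "x \<in> borel_measurable M"
  proof (rule borel_measurableI_less)
    fix c
    show "{\<omega> \<in> space M. x \<omega> < c} \<in> sets M"
      unfolding x_less using D(1) countable_rat by measurable
  qed
  \<comment> \<open>The extra condition on \<open>Re d\<close> pins the limit root to real part
    \<open>x \<omega>\<close>, so that it lies in \<open>Y \<omega>\<close>.\<close>
  have y_less: "y \<omega> < c \<longleftrightarrow> (\<exists>r\<in>\<rat>. r < c \<and>
      (\<forall>k::nat. \<exists>d\<in>D. Im d < r \<and> \<bar>Re d - x \<omega>\<bar> < 1 / Suc k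
         \<and> cmod (poly (p \<omega>) d) < 1 / Suc k))" for \<omega> c
  proof
    assume "y \<omega> < c"
    then obtain r where r: "r \<in> \<rat>" "y \<omega> < r" "r < c" using Rats_dense_in_real by blast
    have "\<exists>d\<in>D. Im d < r \<and> \<bar>Re d - x \<omega>\<bar> < 1 / Suc k \<and> cmod (poly (p \<omega>) d) < 1 / Suc k" for k
    proof -
      let ?U = "{d. Im d < r \<and> \<bar>Re d - x \<omega>\<bar> < 1 / Suc k \<and> cmod (poly (p \<omega>) d) < 1 / Suc k}"
      have "open ?U"
        by (intro open_Collect_conj open_Collect_less continuous_intros)
      moreover have "Complex (x \<omega>) (y \<omega>) \<in> ?U"
        using r root by simp
      ultimately show ?thesis using D(2) by blast
    qed
    with r show "\<exists>r\<in>\<rat>. r < c \<and>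
      (\<forall>k::nat. \<exists>d\<in>D. Im d < r \<and> \<bar>Re d - x \<omega>\<bar> < 1 / Suc k
         \<and> cmod (poly (p \<omega>) d) < 1 / Suc k)" by blast
  next
    assume "\<exists>r\<in>\<rat>. r < c \<and>
      (\<forall>k::nat. \<exists>d\<in>D. Im d < r \<and> \<bar>Re d - x \<omega>\<bar> < 1 / Suc k
         \<and> cmod (poly (p \<omega>) d) < 1 / Suc k)"
    then obtain r d where r: "r < c"
      and d: "\<And>k::nat. Im (d k) < r" "\<And>k::nat. \<bar>Re (d k) - x \<omega>\<bar> < 1 / Suc k"
        "\<And>k::nat. cmod (poly (p \<omega>) (d k)) < 1 / Suc k"
      by metis
    obtain z s where z: "poly (p \<omega>) z = 0" "strict_mono s" "(d \<circ> s) \<longlonglongrightarrow> z"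
      using poly_tendsto_0_imp_subseq_root[OF _ lim0[OF d(3)]] deg \<open>n > 0\<close> by metis
    have "Im z \<le> r"
      by (rule LIMSEQ_le_const2[OF tendsto_Im[OF z(3)]]) (use d in \<open>auto simp: less_imp_le\<close>)
    moreover have "Re z = x \<omega>"
    proof -
      have "(\<lambda>k. Re (d k) - x \<omega>) \<longlonglongrightarrow> 0"
        by (rule Lim_null_comparison[OF _ LIMSEQ_inverse_real_of_nat])
           (use d(2) in \<open>auto simp: inverse_eq_divide less_imp_le\<close>)
      then have "(\<lambda>k. Re (d k)) \<longlonglongrightarrow> x \<omega>" by (simp add: LIM_zero_iff)
      from LIMSEQ_subseq_LIMSEQ[OF this z(2)] tendsto_Re[OF z(3)] show ?thesis
        by (auto simp: o_def intro: LIMSEQ_unique)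
    qed
    ultimately have "y \<omega> \<le> r"
      unfolding y_def using Yfin z(1) by (intro order.trans[OF Min_le]) (auto simp: Y_def Z_def)
    then show "y \<omega> < c" using r by simp
  qed
  have [measurable]: "y \<in> borel_measurable M"
  proof (rule borel_measurableI_less)
    fix c
    show "{\<omega> \<in> space M. y \<omega> < c} \<in> sets M"
      unfolding y_less using D(1) countable_rat by measurable
  qed
  have "(\<lambda>\<omega>. Complex (x \<omega>) (y \<omega>)) \<in> borel_measurable M"
    unfolding Complex_eq by measurable
  with root that show ?thesis by blast
qed

text \<open>Induction on the degree: a measurably chosen root is divided out, and the quotient again
  has measurable coefficients.\<close>

lemma measurable_root_factorization:
  fixes p :: "'a \<Rightarrow> complex poly"
  assumes "\<And>i. (\<lambda>\<omega>. coeff (p \<omega>) i) \<in> borel_measurable M"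
    and "\<And>\<omega>. monic_of_degree n (p \<omega>)"
  shows "\<exists>\<zeta>. (\<forall>i. \<zeta> i \<in> borel_measurable M) \<and> (\<forall>\<omega>. p \<omega> = (\<Prod>i<n. [:- \<zeta> i \<omega>, 1:]))"
  using assms
proof (induction n arbitrary: p)
  case 0
  then have "p \<omega> = 1" for \<omega>
    by (metis degree_0_id lead_coeff_pCons(2) monic_of_degree_def one_pCons pCons_0_0)
  then show ?case by (intro exI[of _ "\<lambda>_ _. 0"]) auto
next
  case (Suc n)
  note [measurable] = Suc.prems(1)
  have deg: "degree (p \<omega>) = Suc n" "lead_coeff (p \<omega>) = 1" for \<omega>
    using Suc.prems(2)[of \<omega>] by (auto simp: monic_of_degree_def)
  obtain \<xi> where [measurable]: "\<xi> \<in> borel_measurable M" and \<xi>: "\<And>\<omega>. poly (p \<omega>) (\<xi> \<omega>) = 0"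
    using measurable_root_selection[of p M "Suc n"] Suc.prems(1) deg(1) by blast
  define q where "q \<omega> = synthetic_div (p \<omega>) (\<xi> \<omega>)" for \<omega>
  have p: "p \<omega> = [:- \<xi> \<omega>, 1:] * q \<omega>" for \<omega>
    using synthetic_div_correct'[of "\<xi> \<omega>" "p \<omega>"] \<xi> by (simp add: q_def)
  have degq: "degree (q \<omega>) = n" for \<omega> using deg by (simp add: q_def degree_synthetic_div)
  have monic: "monic_of_degree n (q \<omega>)" for \<omega>
    using deg(2)[of \<omega>] degq[of \<omega>] unfolding p monic_of_degree_def lead_coeff_mult by simp
  \<comment> \<open>Comparing coefficients in the factorisation \<open>p\<close> expresses each
    coefficient of \<open>q \<omega>\<close> through the next higher one.\<close>
  have rec: "coeff (q \<omega>) i = coeff (p \<omega>) (Suc i) + \<xi> \<omega> * coeff (q \<omega>) (Suc i)" for \<omega> i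
    by (simp add: p)
  have "(\<lambda>\<omega>. coeff (q \<omega>) i) \<in> borel_measurable M" for i
  \<comment> \<open>Downward induction on \<open>i\<close>; in the base case truncated subtraction
    gives \<open>i > n\<close>, beyond the degree of \<open>q \<omega>\<close>.\<close>
  proof (induction "Suc n - i" arbitrary: i)
    case 0
    then have "coeff (q \<omega>) i = 0" for \<omega> by (intro coeff_eq_0) (simp add: degq)
    then show ?case by simp
  next
    case (Suc k)
    then have [measurable]: "(\<lambda>\<omega>. coeff (q \<omega>) (Suc i)) \<in> borel_measurable M" by simp
    show ?case by (subst rec) measurable
  qed
  from Suc.IH[OF this monic] obtain \<zeta> where \<zeta>: "\<And>i. \<zeta> i \<in> borel_measurable M"
    "\<And>\<omega>. q \<omega> = (\<Prod>i<n. [:- \<zeta> i \<omega>, 1:])" by blast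
  show ?case
    by (intro exI[of _ "\<zeta>(n := \<xi>)"])
       (auto simp: \<zeta> p mult.commute intro!: prod.cong)
qed

section \<open>Chebyshev polynomials\<close>

lemma bdd_above_norm_poly:
  "compact E \<Longrightarrow> bdd_above ((\<lambda>z. cmod (poly p z)) ` E)"
  by (intro bounded_imp_bdd_above compact_imp_bounded compact_continuous_image continuous_intros)

lemma norm_poly_le_sup_norm:
  "compact E \<Longrightarrow> z \<in> E \<Longrightarrow> cmod (poly p z) \<le> sup_norm E (poly p)"
  unfolding sup_norm_def by (intro cSUP_upper bdd_above_norm_poly)

lemma sup_norm_le:
  "E \<noteq> {} \<Longrightarrow> (\<And>z. z \<in> E \<Longrightarrow> cmod (g z) \<le> c) \<Longrightarrow> sup_norm E g \<le> c"
  unfolding sup_norm_def by (intro cSUP_least)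

lemma sup_norm_poly_nonneg:
  assumes "compact E" "E \<noteq> {}"
  shows "0 \<le> sup_norm E (poly p)"
proof -
  from assms(2) obtain z where "z \<in> E" by blast
  from norm_poly_le_sup_norm[OF assms(1) this] norm_ge_zero show ?thesis by (rule order_trans[rotated])
qed

lemma sup_norm_poly_attained:
  assumes "compact E" "E \<noteq> {}"
  obtains z where "z \<in> E" "cmod (poly p z) = sup_norm E (poly p)"
proof -
  have "continuous_on E (\<lambda>z. cmod (poly p z))" by (intro continuous_intros)
  from continuous_attains_sup[OF assms this] obtain z
    where z: "z \<in> E" "\<And>w. w \<in> E \<Longrightarrow> cmod (poly p w) \<le> cmod (poly p z)" by blast
  have "sup_norm E (poly p) \<le> cmod (poly p z)" using z by (intro sup_norm_le assms)
  with z(1) norm_poly_le_sup_norm[OF assms(1) z(1), of p] that show ?thesis by force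
qed

section \<open>Existence of Chebyshev polynomials\<close>

lemma monic_of_degree_prod_roots: "monic_of_degree m (\<Prod>i<m. [:- w i, 1:])"
  unfolding monic_of_degree_def
proof (induction m)
  case (Suc m)
  define q where "q = (\<Prod>i<m. [:- w i, 1:])"
  have q: "degree q = m" "lead_coeff q = 1" using Suc by (auto simp: q_def)
  then have "q \<noteq> 0" by auto
  then have "degree ([:- w m, 1:] * q) = Suc m"
    using degree_mult_eq[of "[:- w m, 1:]" q] q by (simp del: mult_pCons_left)
  moreover have "lead_coeff ([:- w m, 1:] * q) = 1"
    using lead_coeff_mult[of "[:- w m, 1:]" q] q by (simp del: mult_pCons_left)
  moreover have "(\<Prod>i<Suc m. [:- w i, 1:]) = [:- w m, 1:] * q"
    by (simp add: q_def mult.commute del: mult_pCons_left mult_pCons_right)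
  ultimately show ?case by metis
qed simp

text \<open>Replacing a root far away from \<open>E\<close> by \<open>0\<close> decreases the modulus on \<open>E\<close>, so the
  minimisation may be restricted to a compact set of root vectors.\<close>

lemma monic_dominated_by_bounded_roots:
  assumes q: "monic_of_degree m q" and E: "\<And>z. z \<in> E \<Longrightarrow> cmod z \<le> R"
  obtains v where "\<And>i. cmod (v i) \<le> 2 * \<bar>R\<bar>"
    "\<And>z. z \<in> E \<Longrightarrow> cmod (poly (\<Prod>i<m. [:- v i, 1:]) z) \<le> cmod (poly q z)"
proof -
  \<comment> \<open>A single polynomial is a family over the one-point space, so the measurable
    factorisation yields an ordinary one.\<close>
  obtain \<zeta> where "q = (\<Prod>i<m. [:- \<zeta> i (), 1:])"
    using measurable_root_factorization[of "\<lambda>_::unit. q" "count_space UNIV" m] q by auto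
  then obtain w where w: "q = (\<Prod>i<m. [:- w i, 1:])"
    by (intro that[of "\<lambda>i. \<zeta> i ()"])
  \<comment> \<open>If |w i| > 2 |R|, then every \<open>z\<close> in \<open>E\<close> satisfies |z -
    w i| >= |w i| - |z| > |R| >= |z|, so the root 0 is closer to \<open>z\<close>.\<close>
  define v where "v i = (if cmod (w i) \<le> 2 * \<bar>R\<bar> then w i else 0)" for i
  have "cmod (poly (\<Prod>i<m. [:- v i, 1:]) z) \<le> cmod (poly q z)" if "z \<in> E" for z
  proof -
    have "cmod (z - v i) \<le> cmod (z - w i)" for i
      using E[OF that] norm_triangle_ineq2[of "w i" z] by (auto simp: v_def norm_minus_commute)
    then have "(\<Prod>i<m. cmod (z - v i)) \<le> (\<Prod>i<m. cmod (z - w i))"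
      by (intro prod_mono) auto
    then show ?thesis unfolding w by (simp add: poly_prod flip: prod_norm)
  qed
  moreover have "cmod (v i) \<le> 2 * \<bar>R\<bar>" for i by (simp add: v_def)
  ultimately show ?thesis using that by blast
qed

text \<open>Bounded root vectors form a compact set by Tychonoff's theorem; a minimising sequence
  has a convergent subsequence, whose limit is a minimiser.\<close>

lemma ex_chebyshev_poly:
  assumes E: "compact E" "E \<noteq> {}"
  shows "\<exists>p. is_chebyshev_poly E m p"
proof -
  from compact_imp_bounded[OF E(1)] obtain R where R: "\<And>z. z \<in> E \<Longrightarrow> cmod z \<le> R"
    by (auto simp: bounded_iff)
  \<comment> \<open>Vectors are infinite sequences, of which \<open>p\<close> reads only the first
    \<open>m\<close> coordinates.\<close>
  define B :: "(nat \<Rightarrow> complex) set" where "B = (UNIV \<rightarrow>\<^sub>E cball 0 (2 * \<bar>R\<bar>))"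
  define p where "p v = (\<Prod>i<m. [:- v i, 1:])" for v :: "nat \<Rightarrow> complex"
  define t where "t = (INF v\<in>B. sup_norm E (poly (p v)))"
  have "compactin (product_topology (\<lambda>_. euclidean) UNIV) B"
    unfolding B_def by (subst compactin_PiE) auto
  then have "compact B"
    by (subst (asm) euclidean_product_topology) simp
  moreover have "(\<lambda>_. 0) \<in> B" by (simp add: B_def PiE_iff)
  ultimately have B: "compact B" "B \<noteq> {}" by auto
  have bdd: "bdd_below ((\<lambda>v. sup_norm E (poly (p v))) ` B)"
    using sup_norm_poly_nonneg[OF E] by (intro bdd_belowI2[of _ 0])
  have "\<exists>v\<in>B. sup_norm E (poly (p v)) < t + 1 / Suc k" for k
    using cINF_less_iff[OF B(2) bdd, of "t + 1 / Suc k"] by (simp add: t_def)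
  then obtain v where v: "\<And>k. v k \<in> B" "\<And>k. sup_norm E (poly (p (v k))) < t + 1 / Suc k"
    by metis
  from B(1) v(1) obtain u r where u: "u \<in> B" "strict_mono r" "(v \<circ> r) \<longlonglongrightarrow> u"
    unfolding compact_def by metis
  have ulim: "(\<lambda>k. v (r k) i) \<longlonglongrightarrow> u i" for i
    using continuous_on_tendsto_compose[OF continuous_on_product_coordinates u(3), of i]
    by (simp add: o_def)
  \<comment> \<open>Convergence at each fixed \<open>z\<close> suffices: the bound passes to the
    limit pointwise, and the supremum is taken afterwards.\<close>
  have "sup_norm E (poly (p u)) \<le> t"
  proof (rule sup_norm_le[OF E(2)])
    fix z assume z: "z \<in> E"
    have lim: "(\<lambda>k. \<Prod>i<m. cmod (z - v (r k) i)) \<longlonglongrightarrow> (\<Prod>i<m. cmod (z - u i))"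
      by (intro tendsto_intros ulim)
    have p_eq: "cmod (poly (p w) z) = (\<Prod>i<m. cmod (z - w i))" for w
      by (simp add: p_def poly_prod flip: prod_norm)
    have "(\<lambda>k. t + 1 / Suc (r k)) \<longlonglongrightarrow> t + 0"
      using LIMSEQ_subseq_LIMSEQ[OF LIMSEQ_inverse_real_of_nat u(2)]
      by (intro tendsto_intros) (simp add: o_def inverse_eq_divide)
    moreover have "cmod (poly (p (v (r k))) z) \<le> t + 1 / Suc (r k)" for k
      using norm_poly_le_sup_norm[OF E(1) z, of "p (v (r k))"] v(2)[of "r k"] by linarith
    ultimately show "cmod (poly (p u) z) \<le> t"
      using LIMSEQ_le[OF lim, of "\<lambda>k. t + 1 / Suc (r k)" "t + 0"] unfolding p_eq by simp
  qed
  moreover have "t \<le> sup_norm E (poly q)" if "monic_of_degree m q" for q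
  proof -
    obtain w where w: "\<And>i. cmod (w i) \<le> 2 * \<bar>R\<bar>"
      "\<And>z. z \<in> E \<Longrightarrow> cmod (poly (p w) z) \<le> cmod (poly q z)"
      using monic_dominated_by_bounded_roots[OF \<open>monic_of_degree m q\<close> R] unfolding p_def by blast
    have "t \<le> sup_norm E (poly (p w))"
      unfolding t_def using w(1) by (intro cINF_lower bdd) (auto simp: B_def PiE_iff)
    also have "\<dots> \<le> sup_norm E (poly q)"
      using w(2) norm_poly_le_sup_norm[OF E(1)] by (intro sup_norm_le[OF E(2)]) (rule order_trans)
    finally show ?thesis .
  qed
  moreover have "monic_of_degree m (p u)"
    unfolding p_def by (rule monic_of_degree_prod_roots)
  ultimately have "is_chebyshev_poly E m (p u)"
    unfolding is_chebyshev_poly_def by (blast intro: order_trans)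
  then show ?thesis ..
qed

section \<open>Uniqueness of Chebyshev polynomials\<close>

text \<open>Newton's scheme: a multiple of the nodal polynomial of \<open>X\<close> corrects the
  value at the new point without disturbing the old ones.\<close>

lemma ex_interpolating_poly:
  fixes g :: "'a::field \<Rightarrow> 'a"
  assumes "finite X"
  shows "\<exists>R. degree R \<le> card X - 1 \<and> (\<forall>x\<in>X. poly R x = g x)"
  using assms
proof (induction X)
  case empty
  show ?case by (intro exI[of _ 0]) simp
next
  case (insert a X)
  then obtain R where R: "degree R \<le> card X - 1" "\<forall>x\<in>X. poly R x = g x" by blast
  define W where "W = (\<Prod>y\<in>X. [:- y, 1:])"
  have "degree W \<le> (\<Sum>y\<in>X. degree [:- y, 1:])"
    unfolding W_def using degree_prod_sum_le[OF insert.hyps(1), of "\<lambda>y. [:- y, 1:]"]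
    by (simp add: o_def)
  then have W: "degree W \<le> card X" by simp
  have Wa: "poly W a \<noteq> 0" and WX: "\<And>x. x \<in> X \<Longrightarrow> poly W x = 0"
    using insert.hyps unfolding W_def poly_prod by auto
  define S where "S = R + smult ((g a - poly R a) / poly W a) W"
  have "degree S \<le> card X"
    unfolding S_def using R(1) W by (intro degree_add_le order_trans[OF degree_smult_le]) auto
  moreover have "\<forall>x\<in>insert a X. poly S x = g x"
    using R(2) Wa WX by (simp add: S_def)
  ultimately show ?case using insert.hyps by (intro exI[of _ S]) simp
qed

text \<open>Kolmogorov's criterion: if a polynomial of lower degree agreed with \<open>A\<close> on the extremal
  points of \<open>A\<close>, subtracting a small multiple of it would decrease the norm of \<open>A\<close>.\<close>

lemma chebyshev_no_interpolation_on_extremal_points: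
  assumes E: "compact E" "E \<noteq> {}" and A: "is_chebyshev_poly E m A"
    and pos: "sup_norm E (poly A) > 0" and R: "degree R < m"
    and eq: "\<And>z. z \<in> E \<Longrightarrow> cmod (poly A z) = sup_norm E (poly A) \<Longrightarrow> poly R z = poly A z"
  shows False
proof -
  define t where "t = sup_norm E (poly A)"
  \<comment> \<open>These perturbations of \<open>A\<close> stay monic of degree \<open>m\<close>,
    since \<open>R\<close> has lower degree; minimality of \<open>A\<close> then yields points
    \<open>z k\<close> where they have modulus at least \<open>t\<close>.\<close>
  define B where "B k = A - smult (of_real (1 / Suc k)) R" for k
  have "monic_of_degree m (B k)" for k
  proof -
    have A': "degree A = m" "coeff A m = 1"
      using A by (auto simp: is_chebyshev_poly_def monic_of_degree_def)
    have "degree (- smult (of_real (1 / Suc k)) R) < degree A"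
      unfolding degree_minus A' by (rule le_less_trans[OF degree_smult_le R])
    from degree_add_eq_left[OF this] have "degree (B k) = m" by (simp add: B_def A')
    moreover have "coeff (B k) m = 1" using R by (simp add: B_def A' coeff_eq_0)
    ultimately show ?thesis by (simp add: monic_of_degree_def)
  qed
  then have "t \<le> sup_norm E (poly (B k))" for k
    using A by (auto simp: t_def is_chebyshev_poly_def)
  then have "\<exists>z\<in>E. t \<le> cmod (poly (B k) z)" for k
    using sup_norm_poly_attained[OF E, of "B k"] by metis
  then obtain z where z: "\<And>k. z k \<in> E" "\<And>k. t \<le> cmod (poly (B k) (z k))" by metis
  from E(1) z(1) obtain u r where u: "u \<in> E" "strict_mono r" "(z \<circ> r) \<longlonglongrightarrow> u"
    unfolding compact_def by metis
  have ulim: "(\<lambda>k. z (r k)) \<longlonglongrightarrow> u" using u(3) by (simp add: o_def)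
  have inv0: "(\<lambda>k. 1 / real (Suc (r k))) \<longlonglongrightarrow> 0"
    using LIMSEQ_subseq_LIMSEQ[OF LIMSEQ_inverse_real_of_nat u(2)]
    by (simp add: o_def inverse_eq_divide)
  have "(\<lambda>k. cmod (poly A (z (r k)) - of_real (1 / Suc (r k)) * poly R (z (r k))))
      \<longlonglongrightarrow> cmod (poly A u - of_real 0 * poly R u)"
    by (intro tendsto_intros ulim inv0)
  then have "t \<le> cmod (poly A u)"
    using z(2) by (intro LIMSEQ_le_const) (auto simp: B_def)
  then have u_ext: "cmod (poly A u) = t"
    using norm_poly_le_sup_norm[OF E(1) u(1), of A] by (simp add: t_def)
  then have RA: "poly R u = poly A u" using eq u(1) by (simp add: t_def)
  \<comment> \<open>Here t <= |a - e b| and |a| <= t; expanding the square and cancelling one factor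
    \<open>e\<close> bounds the inner product.\<close>
  have le: "2 * (poly A (z (r k)) \<bullet> poly R (z (r k))) \<le> 1 / Suc (r k) * (cmod (poly R (z (r k))))\<^sup>2" for k
  proof -
    define e where "e = 1 / real (Suc (r k))"
    define a where "a = poly A (z (r k))"
    define b where "b = poly R (z (r k))"
    have e: "e > 0" by (simp add: e_def)
    have "t\<^sup>2 \<le> (cmod (a - e *\<^sub>R b))\<^sup>2"
      using z(2)[of "r k"] pos
      by (intro power_mono) (auto simp: B_def a_def b_def e_def t_def scaleR_conv_of_real)
    also have "\<dots> = (cmod a)\<^sup>2 - 2 * e * (a \<bullet> b) + e\<^sup>2 * (cmod b)\<^sup>2"
      using dot_norm_neg[of a "e *\<^sub>R b"] by (simp add: power_mult_distrib)
    also have "(cmod a)\<^sup>2 \<le> t\<^sup>2"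
      using norm_poly_le_sup_norm[OF E(1) z(1), of A] by (intro power_mono) (auto simp: a_def t_def)
    finally have "e * (2 * (a \<bullet> b)) \<le> e * (e * (cmod b)\<^sup>2)"
      by (simp add: power2_eq_square algebra_simps)
    with e have "2 * (a \<bullet> b) \<le> e * (cmod b)\<^sup>2" by (simp only: mult_le_cancel_left_pos)
    then show ?thesis by (simp add: a_def b_def e_def)
  qed
  \<comment> \<open>In the limit the inner product at \<open>u\<close> is at most 0, whereas
    \<open>R\<close> and \<open>A\<close> agree there and make it the square of
    \<open>t\<close>.\<close>
  have "(\<lambda>k. 2 * (poly A (z (r k)) \<bullet> poly R (z (r k)))) \<longlonglongrightarrow> 2 * (poly A u \<bullet> poly R u)"
    by (intro tendsto_intros ulim)
  moreover have "(\<lambda>k. 1 / Suc (r k) * (cmod (poly R (z (r k))))\<^sup>2) \<longlonglongrightarrow> 0 * (cmod (poly R u))\<^sup>2"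
    by (intro tendsto_intros ulim inv0)
  ultimately have "2 * (poly A u \<bullet> poly R u) \<le> 0 * (cmod (poly R u))\<^sup>2"
    by (rule LIMSEQ_le) (use le in auto)
  then show False
    using pos by (simp add: RA u_ext t_def flip: power2_norm_eq_inner)
qed

text \<open>The mean \<open>A\<close> of two minimisers is again a minimiser. By the parallelogram
  law \<open>p\<close> and \<open>q\<close> agree at its extremal points, so there are fewer than
  \<open>m\<close> of these; interpolating \<open>A\<close> there contradicts Kolmogorov's
  criterion.\<close>

lemma chebyshev_poly_unique:
  assumes E: "compact E" "infinite E"
    and p: "is_chebyshev_poly E m p" and q: "is_chebyshev_poly E m q"
  shows "p = q"
proof (rule ccontr)
  assume "p \<noteq> q"
  have ne: "E \<noteq> {}" using E(2) by auto
  define t where "t = sup_norm E (poly p)"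
  have monic: "degree p = m" "coeff p m = 1" "degree q = m" "coeff q m = 1"
    using p q by (auto simp: is_chebyshev_poly_def monic_of_degree_def)
  have tq: "sup_norm E (poly q) = t"
    unfolding t_def by (rule antisym) (use p q in \<open>simp_all add: is_chebyshev_poly_def\<close>)
  define A where "A = smult (1/2) (p + q)"
  have "coeff A m = 1" by (simp add: A_def monic)
  moreover have "degree A \<le> m"
    unfolding A_def by (intro order_trans[OF degree_smult_le] degree_add_le) (auto simp: monic)
  ultimately have A: "monic_of_degree m A"
    using le_degree[of A m] by (simp add: monic_of_degree_def)
  have Apoly: "poly A z = (poly p z + poly q z) / 2" for z by (simp add: A_def)
  have bound: "cmod (poly p z) \<le> t" "cmod (poly q z) \<le> t" if "z \<in> E" for z
    using norm_poly_le_sup_norm[OF E(1) that, of p] norm_poly_le_sup_norm[OF E(1) that, of q] tq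
    by (simp_all add: t_def)
  have "sup_norm E (poly A) \<le> t"
  proof (rule sup_norm_le[OF ne])
    fix z assume "z \<in> E"
    from bound[OF this] show "cmod (poly A z) \<le> t"
      using norm_triangle_ineq[of "poly p z" "poly q z"] by (simp add: Apoly norm_divide)
  qed
  then have Anorm: "sup_norm E (poly A) = t"
    by (rule antisym) (use p A in \<open>simp add: is_chebyshev_poly_def t_def\<close>)
  then have Acheb: "is_chebyshev_poly E m A"
    using A p by (simp add: is_chebyshev_poly_def t_def)
  \<comment> \<open>An infinite \<open>E\<close> contains a point that is not a root of
    \<open>A\<close>, which makes the minimal norm \<open>t\<close> positive.\<close>
  have "A \<noteq> 0" using A by (auto simp: monic_of_degree_def)
  then have "finite {z. poly A z = 0}" by (rule poly_roots_finite)
  then obtain z0 where z0: "z0 \<in> E" "poly A z0 \<noteq> 0"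
    using E(2) finite_subset[of E "{z. poly A z = 0}"] by blast
  have "0 < cmod (poly A z0)" using z0(2) by simp
  also have "\<dots> \<le> t" using norm_poly_le_sup_norm[OF E(1) z0(1), of A] unfolding Anorm .
  finally have pos: "t > 0" .
  define X where "X = {z \<in> E. cmod (poly A z) = t}"
  have "poly (p - q) z = 0" if "z \<in> X" for z
  proof -
    have z: "z \<in> E" "cmod (poly p z + poly q z) = 2 * t"
      using that by (auto simp: X_def Apoly norm_divide)
    \<comment> \<open>Both values have modulus at most \<open>t\<close> while their sum has modulus
      \<open>2 * t\<close>, so the parallelogram law leaves nothing for the difference.\<close>
    have "(cmod (poly p z - poly q z))\<^sup>2 =
        2 * (cmod (poly p z))\<^sup>2 + 2 * (cmod (poly q z))\<^sup>2 - (cmod (poly p z + poly q z))\<^sup>2"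
      using dot_norm[of "poly p z" "poly q z"] dot_norm_neg[of "poly p z" "poly q z"] by simp
    also have "\<dots> \<le> 2 * t\<^sup>2 + 2 * t\<^sup>2 - (2 * t)\<^sup>2"
      using bound[OF z(1)] unfolding z(2)
      by (intro diff_right_mono add_mono mult_left_mono power_mono) auto
    finally show ?thesis by (simp add: power_mult_distrib)
  qed
  then have X: "X \<subseteq> {z. poly (p - q) z = 0}" by auto
  have pq: "p - q \<noteq> 0" using \<open>p \<noteq> q\<close> by simp
  have Xfin: "finite X" using X poly_roots_finite[OF pq] finite_subset by blast
  have "card X \<le> degree (p - q)"
    using X card_mono[OF poly_roots_finite[OF pq] X] card_poly_roots_bound[OF pq] by linarith
  moreover have "degree (p - q) < m"
  proof -
    have "degree (p - q) \<le> m" by (intro degree_diff_le) (auto simp: monic)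
    moreover have "degree (p - q) \<noteq> m"
      using pq monic leading_coeff_0_iff[of "p - q"] by auto
    ultimately show ?thesis by simp
  qed
  ultimately have card: "card X < m" by simp
  from ex_interpolating_poly[OF Xfin, of "poly A"] obtain R
    where R: "degree R \<le> card X - 1" "\<forall>x\<in>X. poly R x = poly A x" by blast
  show False
    by (rule chebyshev_no_interpolation_on_extremal_points[OF E(1) ne Acheb, of R])
       (use R card pos in \<open>auto simp: Anorm X_def\<close>)
qed

text \<open>Existence and uniqueness give the definite description in \<open>chebyshev_poly\<close>
  its meaning.\<close>

lemma is_chebyshev_poly_chebyshev_poly:
  assumes "compact E" "infinite E"
  shows "is_chebyshev_poly E m (chebyshev_poly E m)"
proof -
  have "E \<noteq> {}" using assms(2) by auto
  then show ?thesis
    unfolding chebyshev_poly_def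
    using ex_chebyshev_poly[OF assms(1)] chebyshev_poly_unique[OF assms]
    by (metis (mono_tags) theI)
qed

lemma chebyshev_norm_le:
  assumes "compact E" "infinite E" "monic_of_degree m q"
  shows "chebyshev_norm E m \<le> sup_norm E (poly q)"
  using is_chebyshev_poly_chebyshev_poly[OF assms(1,2), of m] assms(3)
  by (auto simp: chebyshev_norm_def is_chebyshev_poly_def)

text \<open>In the competitor \<open>T * S ^ k\<close> each factor \<open>S\<close>, the monic
  multiple of \<open>P\<close>, is bounded on \<open>f\<close> by
  \<open>\<alpha> / cmod (lead_coeff P)\<close>.\<close>

lemma chebyshev_norm_poly_sublevel_le:
  fixes P :: "complex poly"
  assumes P: "degree P = n" "n \<ge> 1" and "\<alpha> > 0"
    and f: "f = {z. cmod (poly P z) \<le> \<alpha>}" "infinite f"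
  shows "chebyshev_norm f (n * k + j) \<le> chebyshev_norm f j * (\<alpha> / cmod (lead_coeff P)) ^ k"
proof -
  have cf: "compact f" using compact_poly_sublevel[of P] P f(1) by simp
  have ne: "f \<noteq> {}" using f(2) by auto
  have lc: "lead_coeff P \<noteq> 0" using P by auto
  define S where "S = smult (1 / lead_coeff P) P"
  have S: "degree S = n" "lead_coeff S = 1" using P lc by (auto simp: S_def)
  define T where "T = chebyshev_poly f j"
  have T: "degree T = j" "lead_coeff T = 1"
    using is_chebyshev_poly_chebyshev_poly[OF cf f(2), of j]
    by (auto simp: T_def is_chebyshev_poly_def monic_of_degree_def)
  have nz: "S \<noteq> 0" "T \<noteq> 0" using S T by auto
  have "monic_of_degree (n * k + j) (T * S ^ k)"
    using nz S T lead_coeff_mult[of T "S ^ k"] lead_coeff_power[of S k]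
    by (simp add: monic_of_degree_def degree_mult_eq degree_power_eq mult.commute add.commute)
  from chebyshev_norm_le[OF cf f(2) this]
  have "chebyshev_norm f (n * k + j) \<le> sup_norm f (poly (T * S ^ k))" .
  also have "\<dots> \<le> chebyshev_norm f j * (\<alpha> / cmod (lead_coeff P)) ^ k"
  proof (rule sup_norm_le[OF ne])
    fix z assume z: "z \<in> f"
    have "cmod (poly S z) \<le> \<alpha> / cmod (lead_coeff P)"
      using z lc unfolding f S_def by (simp add: norm_divide divide_right_mono)
    moreover have "cmod (poly T z) \<le> chebyshev_norm f j"
      unfolding T_def chebyshev_norm_def by (rule norm_poly_le_sup_norm[OF cf z])
    moreover have "0 \<le> chebyshev_norm f j"
      unfolding chebyshev_norm_def by (rule sup_norm_poly_nonneg[OF cf ne])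
    ultimately show "cmod (poly (T * S ^ k) z) \<le> chebyshev_norm f j * (\<alpha> / cmod (lead_coeff P)) ^ k"
      by (simp add: norm_mult norm_power mult_mono power_mono)
  qed
  finally show ?thesis .
qed

section \<open>Logarithmic energy\<close>

lemma borel_measurable_log_kernel [measurable]:
  assumes [measurable]: "g \<in> borel_measurable M" "h \<in> borel_measurable M"
  shows "(\<lambda>x. log_kernel (g x) (h x)) \<in> borel_measurable M"
  unfolding log_kernel_def by measurable

lemma prob_measures_onD:
  assumes "\<mu> \<in> prob_measures_on S" "S \<in> sets borel"
  shows "prob_space \<mu>" "sets \<mu> = sets borel" "AE z in \<mu>. z \<in> S"
proof -
  show *: "prob_space \<mu>" "sets \<mu> = sets borel"
    using assms(1) by (auto simp: prob_measures_on_def)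
  interpret prob_space \<mu> by fact
  have "prob S = 1" using assms(1) by (simp add: prob_measures_on_def measure_def)
  then show "AE z in \<mu>. z \<in> S" by (rule AE_prob_1)
qed

lemma log_kernel_ge:
  assumes "cmod (z - w) \<le> exp L"
  shows "- ereal L \<le> log_kernel z w"
proof (cases "z = w")
  case False
  then have "ln (cmod (z - w)) \<le> ln (exp L)" using assms by (subst ln_le_cancel_iff) auto
  with False show ?thesis by (simp add: log_kernel_def ln_div)
qed (simp add: log_kernel_def)

text \<open>A diameter bound keeps the kernel above \<open>- L\<close>; the subtrahend in
  \<open>log_energy\<close> is thus finite, and the difference never meets infinity minus
  infinity.\<close>

lemma nn_integral_neg_log_kernel_le:
  assumes \<mu>: "\<mu> \<in> prob_measures_on S" "S \<in> sets borel"
    and L: "\<And>z w. z \<in> S \<Longrightarrow> w \<in> S \<Longrightarrow> cmod (z - w) \<le> exp L"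
  shows "(\<integral>\<^sup>+ z. (\<integral>\<^sup>+ w. e2ennreal (- log_kernel z w) \<partial>\<mu>) \<partial>\<mu>) \<le> ennreal L"
proof -
  note AE = prob_measures_onD(3)[OF \<mu>]
  interpret prob_space \<mu> by (rule prob_measures_onD[OF \<mu>])
  have le: "e2ennreal (- log_kernel z w) \<le> ennreal L" if "z \<in> S" "w \<in> S" for z w
    using log_kernel_ge[OF L[OF that]] e2ennreal_mono[of "- log_kernel z w" "ereal L"]
    by (simp add: ereal_uminus_le_reorder)
  have "(\<integral>\<^sup>+ w. e2ennreal (- log_kernel z w) \<partial>\<mu>) \<le> (\<integral>\<^sup>+ w. ennreal L \<partial>\<mu>)" if "z \<in> S" for z
    by (rule nn_integral_mono_AE) (use AE le[OF that] in \<open>auto elim!: eventually_mono\<close>)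
  then have "AE z in \<mu>. (\<integral>\<^sup>+ w. e2ennreal (- log_kernel z w) \<partial>\<mu>) \<le> ennreal L"
    using AE by (simp add: emeasure_space_1 eventually_mono)
  from nn_integral_mono_AE[OF this] show ?thesis by (simp add: emeasure_space_1)
qed

lemma log_energy_ge:
  assumes "\<mu> \<in> prob_measures_on S" "S \<in> sets borel" "L \<ge> 0"
    and "\<And>z w. z \<in> S \<Longrightarrow> w \<in> S \<Longrightarrow> cmod (z - w) \<le> exp L"
  shows "- ereal L \<le> log_energy \<mu>"
proof -
  have "enn2ereal (\<integral>\<^sup>+ z. (\<integral>\<^sup>+ w. e2ennreal (- log_kernel z w) \<partial>\<mu>) \<partial>\<mu>) \<le> enn2ereal (ennreal L)"
    using nn_integral_neg_log_kernel_le[of \<mu> S L] assms unfolding less_eq_ennreal.rep_eq by blast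
  then have "0 - ereal L \<le> log_energy \<mu>"
    unfolding log_energy_def using assms(3)
    by (intro ereal_minus_mono enn2ereal_nonneg) (simp add: enn2ereal_ennreal)
  then show ?thesis by simp
qed

text \<open>Adding \<open>L\<close> makes the kernel nonnegative on \<open>S\<close>, so that the
  bound \<open>V\<close> on the potential can be stated with a single nonnegative integral; the
  proof converts it back to the difference in \<open>log_energy\<close>.\<close>

lemma log_energy_le:
  assumes \<mu>: "\<mu> \<in> prob_measures_on S" "S \<in> sets borel" and "L \<ge> 0"
    and L: "\<And>z w. z \<in> S \<Longrightarrow> w \<in> S \<Longrightarrow> cmod (z - w) \<le> exp L"
    and V: "V + L \<ge> 0" "\<And>z. z \<in> S \<Longrightarrow> (\<integral>\<^sup>+ w. e2ennreal (log_kernel z w + L) \<partial>\<mu>) \<le> ennreal (V + L)"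
  shows "log_energy \<mu> \<le> V"
proof -
  note AE = prob_measures_onD(3)[OF \<mu>]
  interpret prob_space \<mu> by (rule prob_measures_onD[OF \<mu>])
  have [measurable_cong]: "sets \<mu> = sets borel" by (rule prob_measures_onD[OF \<mu>])
  define A where "A = (\<integral>\<^sup>+ z. (\<integral>\<^sup>+ w. e2ennreal (log_kernel z w) \<partial>\<mu>) \<partial>\<mu>)"
  define B where "B = (\<integral>\<^sup>+ z. (\<integral>\<^sup>+ w. e2ennreal (- log_kernel z w) \<partial>\<mu>) \<partial>\<mu>)"
  \<comment> \<open>For a real kernel value x >= - L this is the positive part of x plus L equals x
    + L plus the negative part of x; on the diagonal both sides are infinite. Either side can be
    integrated term by term.\<close>
  have pointwise: "e2ennreal (log_kernel z w) + ennreal L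
      = e2ennreal (log_kernel z w + L) + e2ennreal (- log_kernel z w)" if "z \<in> S" "w \<in> S" for z w
  proof (cases "log_kernel z w")
    case (real x)
    then have "- L \<le> x" using log_kernel_ge[OF L[OF that]] by simp
    then show ?thesis using real \<open>L \<ge> 0\<close>
      by (cases "x \<ge> 0") (simp_all add: ennreal_neg flip: ennreal_plus)
  qed (use log_kernel_ge[OF L[OF that]] in auto)
  have inner: "(\<integral>\<^sup>+ w. e2ennreal (log_kernel z w) \<partial>\<mu>) + ennreal L \<le>
      ennreal (V + L) + (\<integral>\<^sup>+ w. e2ennreal (- log_kernel z w) \<partial>\<mu>)" if z: "z \<in> S" for z
  proof -
    have "(\<integral>\<^sup>+ w. e2ennreal (log_kernel z w) \<partial>\<mu>) + ennreal L
        = (\<integral>\<^sup>+ w. e2ennreal (log_kernel z w) + ennreal L \<partial>\<mu>)"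
      by (subst nn_integral_add) (auto simp: emeasure_space_1)
    also have "\<dots> = (\<integral>\<^sup>+ w. e2ennreal (log_kernel z w + L) + e2ennreal (- log_kernel z w) \<partial>\<mu>)"
      by (rule nn_integral_cong_AE) (use AE pointwise[OF z] in \<open>auto elim!: eventually_mono\<close>)
    also have "\<dots> = (\<integral>\<^sup>+ w. e2ennreal (log_kernel z w + L) \<partial>\<mu>) + (\<integral>\<^sup>+ w. e2ennreal (- log_kernel z w) \<partial>\<mu>)"
      by (rule nn_integral_add) measurable
    also have "\<dots> \<le> ennreal (V + L) + (\<integral>\<^sup>+ w. e2ennreal (- log_kernel z w) \<partial>\<mu>)"
      by (intro add_right_mono V z)
    finally show ?thesis .
  qed
  have "A + ennreal L = (\<integral>\<^sup>+ z. (\<integral>\<^sup>+ w. e2ennreal (log_kernel z w) \<partial>\<mu>) + ennreal L \<partial>\<mu>)"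
    unfolding A_def by (subst nn_integral_add) (auto simp: emeasure_space_1)
  also have "\<dots> \<le> (\<integral>\<^sup>+ z. ennreal (V + L) + (\<integral>\<^sup>+ w. e2ennreal (- log_kernel z w) \<partial>\<mu>) \<partial>\<mu>)"
    by (rule nn_integral_mono_AE) (use AE inner in \<open>auto elim!: eventually_mono\<close>)
  also have "\<dots> = ennreal (V + L) + B"
    unfolding B_def by (subst nn_integral_add) (auto simp: emeasure_space_1)
  finally have AB: "A + ennreal L \<le> ennreal (V + L) + B" .
  \<comment> \<open>\<open>B\<close> is finite, hence so is \<open>A\<close>, and \<open>AB\<close>
    may be rearranged over the reals.\<close>
  have "B \<le> ennreal L" unfolding B_def by (rule nn_integral_neg_log_kernel_le[OF \<mu> L])
  then obtain b where b: "B = ennreal b" "b \<ge> 0"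
    by (cases B) (auto simp: top_unique)
  with AB V(1) have AB': "A + ennreal L \<le> ennreal (V + L + b)" by simp
  then obtain a where a: "A = ennreal a" "a \<ge> 0"
    by (cases A) (auto simp: top_unique)
  with AB' b V(1) \<open>L \<ge> 0\<close> have "a - b \<le> V"
    by (simp flip: ennreal_plus)
  then show ?thesis
    unfolding log_energy_def A_def[symmetric] B_def[symmetric] using a b
    by (simp add: enn2ereal_ennreal)
qed

section \<open>Capacity of polynomial sublevel sets\<close>

text \<open>Mean value property of the holomorphic function Ln (1 - u z), which vanishes at the
  centre; its real part is the logarithm of the modulus.\<close>

lemma has_integral_ln_norm_circle:
  assumes "cmod u < 1"
  shows "((\<lambda>t. ln (cmod (1 - u * exp (2 * of_real pi * \<i> * of_real t)))) has_integral 0) {0..1}"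
proof -
  define e :: "real \<Rightarrow> complex" where "e t = exp (2 * of_real pi * \<i> * of_real t)" for t
  \<comment> \<open>A positive real part keeps the argument off the branch cut of \<open>Ln\<close>
    on the closed disc.\<close>
  have ne: "1 - u * z \<notin> \<real>\<^sub>\<le>\<^sub>0" if "cmod z \<le> 1" for z
  proof -
    have "cmod (u * z) < 1"
      using mult_left_mono[OF that norm_ge_zero[of u]] assms by (simp add: norm_mult)
    then have "Re (1 - u * z) > 0" using abs_Re_le_cmod[of "u * z"] by simp
    then show ?thesis by (auto simp: complex_nonpos_Reals_iff)
  qed
  have "(\<lambda>z. Ln (1 - u * z)) holomorphic_on cball 0 1"
    using ne by (intro holomorphic_intros) (auto simp: dist_norm)
  from Cauchy_integral_circlepath_simple[OF this, of 0]
  have "((\<lambda>z. Ln (1 - u * z) / z) has_contour_integral 0) (circlepath 0 1)" by simp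
  \<comment> \<open>The derivative of the circle path contributes a factor \<open>e t\<close>, which
    cancels the denominator of Cauchy's integrand.\<close>
  then have "((\<lambda>t. Ln (1 - u * e t) / e t * (2 * of_real pi * \<i> * e t)) has_integral 0) {0..1}"
    unfolding has_contour_integral_def
    by (rule has_integral_eq[rotated], subst vector_derivative_circlepath01)
       (auto simp: circlepath e_def)
  then have "((\<lambda>t. 1 / (2 * of_real pi * \<i>) * (Ln (1 - u * e t) / e t * (2 * of_real pi * \<i> * e t)))
      has_integral 1 / (2 * of_real pi * \<i>) * 0) {0..1}"
    by (rule has_integral_mult_right)
  then have "((\<lambda>t. Ln (1 - u * e t)) has_integral 0) {0..1}"
    by (simp add: e_def)
  from has_integral_linear[OF this bounded_linear_Re]
  have "((\<lambda>t. Re (Ln (1 - u * e t))) has_integral 0) {0..1}" by (simp add: o_def)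
  then show ?thesis
  proof (rule has_integral_eq[rotated])
    fix t :: real
    have "1 - u * e t \<noteq> 0" using ne[of "e t"] by (auto simp: e_def)
    then show "Re (Ln (1 - u * e t)) = ln (cmod (1 - u * exp (2 * of_real pi * \<i> * of_real t)))"
      by (simp add: e_def)
  qed
qed

text \<open>The parameters that hit \<open>c\<close> form at most one translate of the integers.
  This discards the points where the logarithm is singular.\<close>

lemma AE_circle_neq: "AE t in lborel. exp (2 * of_real pi * \<i> * of_real t) \<noteq> (c :: complex)"
proof (cases "\<exists>t0::real. exp (2 * of_real pi * \<i> * of_real t0) = c")
  case True
  then obtain t0 :: real where t0: "exp (2 * of_real pi * \<i> * of_real t0) = c" by blast
  have "{t::real. exp (2 * of_real pi * \<i> * of_real t) = c} \<subseteq> range (\<lambda>n::int. t0 + of_int n)"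
  proof
    fix t :: real assume "t \<in> {t. exp (2 * of_real pi * \<i> * of_real t) = c}"
    then have "exp (2 * of_real pi * \<i> * of_real t) = exp (2 * of_real pi * \<i> * of_real t0)"
      using t0 by simp
    then obtain n :: int where
      "2 * of_real pi * \<i> * of_real t = 2 * of_real pi * \<i> * of_real t0 + of_int (2 * n) * pi * \<i>"
      unfolding exp_eq by blast
    from arg_cong[OF this, of Im] have "2 * pi * t = 2 * pi * (t0 + of_int n)"
      by (simp add: algebra_simps)
    then show "t \<in> range (\<lambda>n::int. t0 + of_int n)" by simp
  qed
  then have "countable {t::real. exp (2 * of_real pi * \<i> * of_real t) = c}"
    by (rule countable_subset) simp
  from AE_not_in[OF countable_imp_null_set_lborel[OF this]] show ?thesis by simp
qed simp

text \<open>Only this inequality is needed at the boundary \<open>|c| = 1\<close>; Fatou's lemma provides it.\<close>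

lemma nn_integral_ln_norm_circle_le:
  assumes c: "cmod c = 1" and L: "L \<ge> ln 2"
  shows "(\<integral>\<^sup>+ t. ennreal (L - ln (cmod (1 - c * exp (2 * of_real pi * \<i> * of_real t)))) * indicator {0..1} t
      \<partial>lborel) \<le> ennreal L"
proof -
  define e :: "real \<Rightarrow> complex" where "e t = exp (2 * of_real pi * \<i> * of_real t)" for t
  have e: "cmod (e t) = 1" for t by (simp add: e_def)
  have e_meas [measurable]: "e \<in> borel_measurable borel"
    unfolding e_def by (intro borel_measurable_continuous_onI continuous_intros)
  \<comment> \<open>Radii below 1 tending to 1; at each of them the circle mean of the logarithm is
    exactly 0.\<close>
  define r where "r k = 1 - 1 / real (k + 2)" for k
  have r: "0 \<le> r k" "r k < 1" for k by (auto simp: r_def)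
  define h where "h k t = ennreal (L - ln (cmod (1 - (r k * c) * e t))) * indicator {0..1} t" for k t
  \<comment> \<open>The modulus is below 2, so L >= ln 2 makes the integrand nonnegative, as Fatou's
    lemma demands.\<close>
  have nn: "L - ln (cmod (1 - (r k * c) * e t)) \<ge> 0" for k t
  proof -
    have "cmod ((r k * c) * e t) < 1" using r c e by (simp add: norm_mult)
    then have "cmod (1 - (r k * c) * e t) > 0" "cmod (1 - (r k * c) * e t) < 2"
      using norm_triangle_ineq4[of 1 "(r k * c) * e t"] by auto
    then have "ln (cmod (1 - (r k * c) * e t)) \<le> ln 2" by simp
    then show ?thesis using L by simp
  qed
  have int: "integral\<^sup>N lborel (h k) = ennreal L" for k
  proof -
    have "cmod (r k * c) < 1" using r c by (simp add: norm_mult)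
    from has_integral_diff[OF has_integral_const_real[of L 0 1] has_integral_ln_norm_circle[OF this]]
    have "((\<lambda>t. L - ln (cmod (1 - (r k * c) * e t))) has_integral L) {0..1}"
      by (simp add: e_def)
    from nn_integral_has_integral_lebesgue'[OF nn this] show ?thesis by (simp add: h_def[abs_def])
  qed
  have lim: "(\<lambda>k. h k t) \<longlonglongrightarrow> ennreal (L - ln (cmod (1 - c * e t))) * indicator {0..1} t"
    if "1 - c * e t \<noteq> 0" for t
  proof -
    have "(\<lambda>k. 1 / real (k + 2)) \<longlonglongrightarrow> 0"
      using LIMSEQ_ignore_initial_segment[OF lim_inverse_n', of 2] by simp
    then have "r \<longlonglongrightarrow> 1 - 0" unfolding r_def by (intro tendsto_intros)
    then have "(\<lambda>k. L - ln (cmod (1 - (r k * c) * e t))) \<longlonglongrightarrow> L - ln (cmod (1 - (of_real 1 * c) * e t))"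
      using that by (intro tendsto_intros) auto
    then show ?thesis
      unfolding h_def by (auto simp: indicator_def intro!: tendsto_intros)
  qed
  \<comment> \<open>Where \<open>e t = 1 / c\<close>, the convention \<open>ln 0 = 0\<close> would
    spoil the convergence; this happens only on a null set.\<close>
  have "AE t in lborel. e t \<noteq> 1 / c" unfolding e_def by (rule AE_circle_neq)
  then have "AE t in lborel. ennreal (L - ln (cmod (1 - c * e t))) * indicator {0..1} t
      = liminf (\<lambda>k. h k t)"
  proof eventually_elim
    case (elim t)
    moreover have "c \<noteq> 0" using c by auto
    ultimately have "1 - c * e t \<noteq> 0" by (auto simp: eq_divide_eq mult.commute)
    from lim_imp_Liminf[OF _ lim[OF this]] show ?case by simp
  qed
  then have "(\<integral>\<^sup>+ t. ennreal (L - ln (cmod (1 - c * e t))) * indicator {0..1} t \<partial>lborel)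
      = (\<integral>\<^sup>+ t. liminf (\<lambda>k. h k t) \<partial>lborel)"
    by (rule nn_integral_cong_AE)
  also have "\<dots> \<le> liminf (\<lambda>k. integral\<^sup>N lborel (h k))"
    by (rule nn_integral_liminf) (simp add: h_def[abs_def])
  also have "\<dots> = ennreal L" unfolding int by (rule Liminf_const) simp
  finally show ?thesis unfolding e_def .
qed

section \<open>Pull-back of the circle measure and the Robin constant\<close>

lemma robin_constant_poly_sublevel_le:
  fixes P :: "complex poly"
  assumes P: "degree P = n" "n \<ge> 1" and "\<alpha> > 0"
  shows "robin_constant {z. cmod (poly P z) \<le> \<alpha>} \<le> ereal (ln (cmod (lead_coeff P) / \<alpha>) / n)"
proof -
  define a where "a = lead_coeff P"
  have a: "a \<noteq> 0" using P by (auto simp: a_def)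
  have n: "n > 0" using P by simp
  define e :: "real \<Rightarrow> complex" where "e t = exp (2 * of_real pi * \<i> * of_real t)" for t
  have e_norm: "cmod (e t) = 1" for t by (simp add: e_def)
  have [measurable]: "e \<in> borel_measurable borel"
    unfolding e_def by (intro borel_measurable_continuous_onI continuous_intros)
  define U where "U = uniform_measure lborel {0..1::real}"
  have [measurable_cong]: "sets U = sets borel" by (simp add: U_def)
  interpret U: prob_space U
    unfolding U_def by (intro prob_space_uniform_measure) auto
  \<comment> \<open>The roots of \<open>p t\<close> are the solutions of P z = \<alpha> e(t),
    counted with multiplicity.\<close>
  define p where "p t = smult (1 / a) (P - [:\<alpha> * e t:])" for t
  have monic: "monic_of_degree n (p t)" for t
  proof -
    have "degree (- [:\<alpha> * e t:]) < degree P" using P by simp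
    from degree_add_eq_left[OF this, folded diff_conv_add_uminus] have "degree (p t) = n" using a P by (simp add: p_def)
    moreover have "coeff (p t) n = 1"
      using a P by (cases n) (auto simp: p_def a_def)
    ultimately show ?thesis by (simp add: monic_of_degree_def)
  qed
  have "(\<lambda>t. coeff (p t) i) \<in> borel_measurable U" for i
    by (cases i) (simp_all add: p_def)
  from measurable_root_factorization[OF this monic] obtain \<zeta>
    where [measurable]: "\<And>i. \<zeta> i \<in> borel_measurable U"
      and \<zeta>: "\<And>t. p t = (\<Prod>i<n. [:- \<zeta> i t, 1:])" by blast
  have p_prod: "poly (p t) z = (\<Prod>i<n. z - \<zeta> i t)" for t z
    unfolding \<zeta> by (simp add: poly_prod)
  have p_eval: "poly (p t) z = (poly P z - \<alpha> * e t) / a" for t z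
    by (simp add: p_def field_simps)
  have root: "poly P (\<zeta> i t) = \<alpha> * e t" if "i < n" for i t
  proof -
    have "poly (p t) (\<zeta> i t) = 0" unfolding p_prod using that by auto
    then show ?thesis using a by (simp add: p_eval)
  qed

  \<comment> \<open>\<open>N\<close> draws an index below \<open>n\<close>, \<open>U\<close> draws a
    parameter, and \<open>g\<close> maps the pair to the corresponding root.\<close>
  define N where "N = pmf_of_set {..<n}"
  define g where "g x = \<zeta> (fst x) (snd x)" for x
  have g_meas [measurable]: "g \<in> borel_measurable (measure_pmf N \<Otimes>\<^sub>M U)"
  proof -
    \<comment> \<open>The index is discrete, so joint measurability reduces to measurability for
      each fixed index.\<close>
    have "g \<in> borel_measurable (count_space UNIV \<Otimes>\<^sub>M U)"
      by (rule measurable_pair_measure_countable1) (auto simp: g_def)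
    then show ?thesis
      by (subst measurable_cong_sets[OF sets_pair_measure_cong[OF sets_measure_pmf_count_space refl] refl])
  qed
  define \<mu> where "\<mu> = distr (measure_pmf N \<Otimes>\<^sub>M U) borel g"
  have \<mu>_int: "integral\<^sup>N \<mu> h = (\<Sum>i<n. \<integral>\<^sup>+ t. h (\<zeta> i t) \<partial>U) / n"
    if [measurable]: "h \<in> borel_measurable borel" for h
  proof -
    have "integral\<^sup>N \<mu> h = (\<integral>\<^sup>+ x. h (g x) \<partial>(measure_pmf N \<Otimes>\<^sub>M U))"
      unfolding \<mu>_def by (rule nn_integral_distr) measurable
    also have "\<dots> = (\<integral>\<^sup>+ i. \<integral>\<^sup>+ t. h (g (i, t)) \<partial>U \<partial>measure_pmf N)"
      by (rule U.nn_integral_fst[symmetric]) measurable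
    also have "\<dots> = (\<Sum>i<n. \<integral>\<^sup>+ t. h (\<zeta> i t) \<partial>U) / card {..<n}"
      unfolding N_def g_def by (subst nn_integral_pmf_of_set) (use n in auto)
    finally show ?thesis by simp
  qed

  \<comment> \<open>The measure lives on the level curve \<open>S\<close>, so the potential has to
    be bounded only there; the Robin constant concerns measures on the full set
    \<open>F\<close>.\<close>
  define S where "S = {z. cmod (poly P z) = \<alpha>}"
  have S_borel [measurable]: "S \<in> sets borel"
    unfolding S_def by (intro borel_closed closed_Collect_eq continuous_intros)
  have prob: "prob_space \<mu>"
    unfolding \<mu>_def
    by (intro prob_space.prob_space_distr prob_space_pair prob_space_measure_pmf U.prob_space_axioms g_meas)
  have "emeasure \<mu> S = (\<integral>\<^sup>+ z. indicator S z \<partial>\<mu>)"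
    by (rule nn_integral_indicator[symmetric]) (simp add: \<mu>_def)
  also have "\<dots> = (\<Sum>i<n. \<integral>\<^sup>+ t. indicator S (\<zeta> i t) \<partial>U) / n"
    by (rule \<mu>_int) measurable
  also have "(\<Sum>i<n. \<integral>\<^sup>+ t. indicator S (\<zeta> i t) \<partial>U) = (\<Sum>i<n. \<integral>\<^sup>+ t. 1 \<partial>U)"
    using root e_norm \<open>\<alpha> > 0\<close>
    by (intro sum.cong refl nn_integral_cong) (auto simp: S_def norm_mult)
  also have "(\<Sum>i<n. \<integral>\<^sup>+ t. 1 \<partial>U) / n = 1"
    using n by (simp add: U.emeasure_space_1 ennreal_of_nat_eq_real_of_nat divide_ennreal)
  finally have \<mu>: "\<mu> \<in> prob_measures_on S"
    using prob by (simp add: prob_measures_on_def \<mu>_def)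

  define F where "F = {z. cmod (poly P z) \<le> \<alpha>}"
  have SF: "S \<subseteq> F" by (auto simp: S_def F_def)
  have "compact F" unfolding F_def using P by (intro compact_poly_sublevel) simp
  have F_borel: "F \<in> sets borel" using \<open>compact F\<close> by (simp add: borel_closed compact_imp_closed)
  have "emeasure \<mu> F = 1"
  proof (rule antisym)
    show "emeasure \<mu> F \<le> 1" using prob by (rule prob_space.measure_le_1)
    have "emeasure \<mu> S \<le> emeasure \<mu> F"
      by (rule emeasure_mono[OF SF]) (simp add: F_borel \<mu>_def)
    then show "1 \<le> emeasure \<mu> F" using \<mu> by (simp add: prob_measures_on_def)
  qed
  then have \<mu>F: "\<mu> \<in> prob_measures_on F" using \<mu> by (simp add: prob_measures_on_def)

  from \<open>compact F\<close> obtain R where R: "\<And>z. z \<in> F \<Longrightarrow> cmod z \<le> R"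
    using compact_imp_bounded bounded_iff by metis
  define v where "v = ln (cmod a / \<alpha>)"
  \<comment> \<open>The first two summands give n L + v >= ln 2 for the circle estimate; the last
    one covers the diameter, with the 1 keeping the argument of \<open>ln\<close> positive.\<close>
  define L where "L = ln 2 + \<bar>v\<bar> + \<bar>ln (2 * \<bar>R\<bar> + 1)\<bar>"
  have L: "L \<ge> ln 2 + \<bar>v\<bar>" "L \<ge> 0" by (auto simp: L_def)
  have "n * L \<ge> 1 * L" using P L by (intro mult_right_mono) auto
  then have nL: "n * L + v \<ge> ln 2" using L by linarith
  then have nL0: "n * L + v \<ge> 0" using ln_ge_zero[of 2] by linarith
  have diam: "cmod (z - w) \<le> exp L" if "z \<in> S" "w \<in> S" for z w
  proof -
    have "cmod (z - w) \<le> 2 * \<bar>R\<bar> + 1"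
      using norm_triangle_ineq4[of z w] R[of z] R[of w] that SF by force
    also have "\<dots> = exp (ln (2 * \<bar>R\<bar> + 1))" by simp
    also have "\<dots> \<le> exp L" unfolding exp_le_cancel_iff by (simp add: L_def)
    finally show ?thesis .
  qed
  have "log_energy \<mu> \<le> ereal (v / n)"
  proof (rule log_energy_le[OF \<mu> S_borel L(2) diam])
    have vL: "v / n + L = (n * L + v) / n" using n by (simp add: field_simps)
    then show "0 \<le> v / n + L" using nL0 by simp
    fix z assume z: "z \<in> S"
    \<comment> \<open>Chosen so that P z - \<alpha> e(t) = P z (1 - c e(t)); it is unimodular
      because \<open>z\<close> lies on \<open>S\<close>.\<close>
    define c where "c = \<alpha> / poly P z"
    have Pz: "poly P z \<noteq> 0" using z \<open>\<alpha> > 0\<close> by (auto simp: S_def)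
    have c: "cmod c = 1" using z \<open>\<alpha> > 0\<close> by (auto simp: c_def S_def norm_divide)
    \<comment> \<open>Summing over \<open>i\<close> turns the distances to the roots into the
      modulus of \<open>poly (p t) z\<close>, which is \<alpha> / |a| times |1 - c e(t)|.\<close>
    have ptw: "(\<Sum>i<n. e2ennreal (log_kernel z (\<zeta> i t) + L)) = ennreal (n * L + v - ln (cmod (1 - c * e t)))"
      if t: "e t \<noteq> 1 / c" for t
    proof -
      have "poly P z - \<alpha> * e t = poly P z * (1 - c * e t)"
        using Pz by (simp add: c_def right_diff_distrib)
      then have p_z: "poly (p t) z = poly P z / a * (1 - c * e t)" by (simp add: p_eval)
      have "c \<noteq> 0" using c by auto
      with t have ne: "1 - c * e t \<noteq> 0" by (auto simp: eq_divide_eq mult.commute)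
      then have "poly (p t) z \<noteq> 0" using p_z Pz a by simp
      then have \<zeta>_ne: "z - \<zeta> i t \<noteq> 0" if "i < n" for i
        using that unfolding p_prod by auto
      have "(\<Sum>i<n. e2ennreal (log_kernel z (\<zeta> i t) + L)) = (\<Sum>i<n. ennreal (L - ln (cmod (z - \<zeta> i t))))"
        using \<zeta>_ne by (intro sum.cong refl) (auto simp: log_kernel_def ln_div)
      also have "\<dots> = ennreal (\<Sum>i<n. L - ln (cmod (z - \<zeta> i t)))"
      proof (rule sum_ennreal)
        fix i assume "i \<in> {..<n}"
        then have "\<zeta> i t \<in> S" "cmod (z - \<zeta> i t) > 0"
          using root[of i t] e_norm \<zeta>_ne \<open>\<alpha> > 0\<close> by (auto simp: S_def norm_mult)
        then have "ln (cmod (z - \<zeta> i t)) \<le> ln (exp L)"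
          using diam[OF z] by (subst ln_le_cancel_iff) auto
        then show "0 \<le> L - ln (cmod (z - \<zeta> i t))" by simp
      qed
      also have "(\<Sum>i<n. L - ln (cmod (z - \<zeta> i t))) = n * L - ln (\<Prod>i<n. cmod (z - \<zeta> i t))"
        using \<zeta>_ne by (subst ln_prod) (auto simp: sum_subtractf)
      also have "(\<Prod>i<n. cmod (z - \<zeta> i t)) = cmod (poly (p t) z)"
        unfolding p_prod by (simp add: prod_norm)
      also have "\<dots> = \<alpha> / cmod a * cmod (1 - c * e t)"
        using z by (simp add: p_z norm_mult norm_divide S_def)
      also have "ln \<dots> = - v + ln (cmod (1 - c * e t))"
        using ne a \<open>\<alpha> > 0\<close> by (simp add: v_def ln_mult ln_div)
      finally show ?thesis by (simp add: algebra_simps)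
    qed
    have "(\<integral>\<^sup>+ w. e2ennreal (log_kernel z w + L) \<partial>\<mu>)
        = (\<Sum>i<n. \<integral>\<^sup>+ t. e2ennreal (log_kernel z (\<zeta> i t) + L) \<partial>U) / n"
      by (rule \<mu>_int) measurable
    also have "(\<Sum>i<n. \<integral>\<^sup>+ t. e2ennreal (log_kernel z (\<zeta> i t) + L) \<partial>U)
        = (\<integral>\<^sup>+ t. (\<Sum>i<n. e2ennreal (log_kernel z (\<zeta> i t) + L)) \<partial>U)"
      by (rule nn_integral_sum[symmetric]) measurable
    also have "\<dots> = (\<integral>\<^sup>+ t. ennreal (n * L + v - ln (cmod (1 - c * e t))) \<partial>U)"
    proof (rule nn_integral_cong_AE)
      have "AE t in U. e t \<noteq> 1 / c"
        unfolding U_def by (rule AE_uniform_measureI) (use AE_circle_neq[of "1 / c"] in \<open>auto simp: e_def\<close>)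
      then show "AE t in U. (\<Sum>i<n. e2ennreal (log_kernel z (\<zeta> i t) + L))
          = ennreal (n * L + v - ln (cmod (1 - c * e t)))"
        by (rule eventually_mono) (rule ptw)
    qed
    also have "\<dots> = (\<integral>\<^sup>+ t. ennreal (n * L + v - ln (cmod (1 - c * e t))) * indicator {0..1} t \<partial>lborel)"
      unfolding U_def by (subst nn_integral_uniform_measure) (auto simp: divide_ennreal_def)
    also have "\<dots> \<le> ennreal (n * L + v)"
      unfolding e_def by (rule nn_integral_ln_norm_circle_le[OF c nL])
    finally have "(\<integral>\<^sup>+ w. e2ennreal (log_kernel z w + L) \<partial>\<mu>) \<le> ennreal (n * L + v) / n"
      by (simp add: divide_right_mono_ennreal)
    also have "\<dots> = ennreal ((n * L + v) / n)"
      using n nL0 by (subst divide_ennreal[symmetric]) (auto simp: ennreal_of_nat_eq_real_of_nat)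
    finally show "(\<integral>\<^sup>+ w. e2ennreal (log_kernel z w + L) \<partial>\<mu>) \<le> ennreal (v / n + L)"
      unfolding vL .
  qed
  then show ?thesis
    unfolding robin_constant_def v_def a_def F_def[symmetric]
    by (rule INF_lower2[OF \<mu>F])
qed

section \<open>From the Robin constant to the capacity\<close>

text \<open>Bounded diameter bounds all energies from below at once. This excludes the case in which
  \<open>real_of_ereal\<close> would return its default 0 in \<open>log_capacity\<close>.\<close>

lemma robin_constant_ne_minus_infinity:
  assumes "compact E"
  shows "robin_constant E \<noteq> -\<infinity>"
proof -
  from compact_imp_bounded[OF assms] obtain R where R: "\<And>z. z \<in> E \<Longrightarrow> cmod z \<le> R"
    by (auto simp: bounded_iff)
  define L where "L = 2 * \<bar>R\<bar>"
  have "- ereal L \<le> robin_constant E"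
    unfolding robin_constant_def
  proof (rule INF_greatest)
    fix \<mu> assume "\<mu> \<in> prob_measures_on E"
    moreover have "cmod (z - w) \<le> exp L" if "z \<in> E" "w \<in> E" for z w
    proof -
      have "cmod (z - w) \<le> L"
        using norm_triangle_ineq4[of z w] R[OF that(1)] R[OF that(2)] by (simp add: L_def)
      also have "L \<le> exp L" using exp_ge_add_one_self[of L] by linarith
      finally show ?thesis .
    qed
    ultimately show "- ereal L \<le> log_energy \<mu>"
      using assms by (intro log_energy_ge) (auto simp: L_def borel_closed compact_imp_closed)
  qed
  then show ?thesis by auto
qed

text \<open>Exponentiates the Robin bound. Positivity lets Widom factors be multiplied back by
  powers of the capacity; division by a zero capacity would return the default 0.\<close>

lemma log_capacity_poly_sublevel_ge:
  fixes P :: "complex poly"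
  assumes P: "degree P = n" "n \<ge> 1" and "\<alpha> > 0" and F: "F = {z. cmod (poly P z) \<le> \<alpha>}"
  shows "log_capacity F > 0" "\<alpha> / cmod (lead_coeff P) \<le> log_capacity F ^ n"
proof -
  have a: "lead_coeff P \<noteq> 0" using P by auto
  define v where "v = ln (cmod (lead_coeff P) / \<alpha>)"
  have up: "robin_constant F \<le> ereal (v / n)"
    unfolding F v_def by (rule robin_constant_poly_sublevel_le[OF assms(1-3)])
  have "compact F" unfolding F using P by (intro compact_poly_sublevel) simp
  then have "robin_constant F \<noteq> -\<infinity>" by (rule robin_constant_ne_minus_infinity)
  with up obtain x where x: "robin_constant F = ereal x" "x \<le> v / n"
    by (cases "robin_constant F") auto
  then have C: "log_capacity F = exp (- x)" by (simp add: log_capacity_def)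
  show "log_capacity F > 0" by (simp add: C)
  have "\<alpha> / cmod (lead_coeff P) = exp (- v)"
    using a \<open>\<alpha> > 0\<close> by (simp add: v_def exp_minus field_simps)
  also have "\<dots> \<le> exp (n * - x)" using x(2) P by (simp add: field_simps)
  also have "\<dots> = log_capacity F ^ n" by (simp only: C exp_of_nat_mult)
  finally show "\<alpha> / cmod (lead_coeff P) \<le> log_capacity F ^ n" .
qed

section \<open>Reduction to degrees below \<open>n\<close>\<close>

theorem theorem1p3:
  fixes n :: nat and P :: "complex poly" and \<alpha> :: real
    and f :: "complex set" and Q :: real
  assumes "n \<ge> 1"
    and "degree P = n"
    and "\<alpha> > 0"
    and "f = {z. cmod (poly P z) \<le> \<alpha>}"
    and "Q = (MAX j\<in>{0..n-1}. widom_factor f j)"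
  shows "\<forall>m::nat. chebyshev_norm f m \<le> Q * log_capacity f ^ m"
proof
  fix m :: nat
  define C where "C = log_capacity f"
  define r where "r = \<alpha> / cmod (lead_coeff P)"
  have C: "C > 0" "r \<le> C ^ n"
    unfolding C_def r_def using log_capacity_poly_sublevel_ge[OF assms(2,1,3,4)] by auto
  have "r \<ge> 0" using \<open>\<alpha> > 0\<close> by (simp add: r_def)
  have inf: "infinite f" unfolding assms(4) using assms by (intro infinite_poly_sublevel) auto
  have cf: "compact f" unfolding assms(4) using assms by (intro compact_poly_sublevel) simp
  \<comment> \<open>The remainder \<open>j\<close> is at most \<open>n - 1\<close>, hence an index
    of the maximum \<open>Q\<close>; the quotient \<open>k\<close> counts the factors
    \<open>r\<close>.\<close>
  define j where "j = m mod n"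
  define k where "k = m div n"
  have m: "m = n * k + j" by (simp add: j_def k_def)
  have "j < n" using assms(1) by (simp add: j_def)
  then have "widom_factor f j \<le> Q" unfolding assms(5) by (intro Max_ge) auto
  then have t: "chebyshev_norm f j \<le> Q * C ^ j"
    using C(1) by (simp add: widom_factor_def C_def pos_divide_le_eq)
  have t0: "0 \<le> chebyshev_norm f j"
    unfolding chebyshev_norm_def using inf by (intro sup_norm_poly_nonneg cf) auto
  have "chebyshev_norm f m \<le> chebyshev_norm f j * r ^ k"
    unfolding m r_def by (rule chebyshev_norm_poly_sublevel_le[OF assms(2,1,3,4) inf])
  \<comment> \<open>Nonnegativity of \<open>Q * C ^ j\<close>, needed to multiply the two
    inequalities, follows from \<open>t0\<close> and \<open>t\<close>.\<close>
  also have "\<dots> \<le> (Q * C ^ j) * (C ^ n) ^ k"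
    using t t0 C(2) \<open>r \<ge> 0\<close> by (intro mult_mono power_mono) auto
  also have "\<dots> = Q * C ^ m" unfolding m power_add power_mult by simp
  finally show "chebyshev_norm f m \<le> Q * log_capacity f ^ m" unfolding C_def .
qed

end
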